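(* Let $n \geq 2$ and let $\mathcal{G}$ be a germ of (singular) holomorphic foliation of codimension one at $(\mathbb{C}^{n},0)$. Suppose that $\mathcal{G}$ is tangent to the levels of a non-constant germ of real meromorphic function with real values $f \in \mathcal{Q}_{n\mathbb{R}}$. Then $\mathcal{G}$ admits a meromorphic first integral, that is, there is a non-constant germ of (complex) meromorphic function at $(\mathbb{C}^{n},0)$ that is constant along the leaves of $\mathcal{G}$.
   Context: $\mathcal{A}_{n\mathbb{R}}$ denotes the ring of germs at $(\mathbb{C}^{n},0)$ of real analytic functions with real values (with $\mathbb{C}^n \simeq \mathbb{R}^{2n}$), and $\mathcal{Q}_{n\mathbb{R}}$ denotes its field of fractions, whose elements are called real meromorphic functions with real values. A germ of holomorphic foliation of codimension one at $(\mathbb{C}^n,0)$ is the object defined by a germ of holomorphic $1$-form $\sigma$, with coefficients without common factors in $\mathcal{O}_n$, which is integrable: $\sigma \wedge d\sigma = 0$. The foliation is tangent to the levels of $f$ if $f$ is constant along its leaves (where defined), i.e. $df \wedge \sigma \wedge \bar{\sigma} = 0$. *)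

theory Defs
  imports "HOL-Analysis.Analysis"
begin

text \<open>Germs at the origin of \<open>\<complex>\<^sup>n\<close> are represented by functions on the whole space; two functions
  define the same germ iff they agree eventually in \<open>nhds 0\<close>, and every notion below depends only
  on germs.\<close>

definition holomorphic_germ :: "(complex ^ 'n \<Rightarrow> complex) \<Rightarrow> bool" where
  "holomorphic_germ f \<longleftrightarrow>
     (\<forall>\<^sub>F z in nhds 0. \<exists>D. (f has_derivative D) (at z) \<and> (\<forall>c v. D (c *s v) = c * D v))"

text \<open>Real analyticity refers to the real coordinates \<open>Re z\<^sub>i, Im z\<^sub>i\<close> of \<open>\<complex>\<^sup>n \<simeq> \<real>\<^sup>2\<^sup>n\<close>: the function is
  the sum of a convergent power series in them.\<close>

definition real_analytic_germ :: "(complex ^ 'n \<Rightarrow> real) \<Rightarrow> bool" where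
  "real_analytic_germ f \<longleftrightarrow>
     (\<exists>c :: ('n \<Rightarrow> nat) \<Rightarrow> ('n \<Rightarrow> nat) \<Rightarrow> real. \<forall>\<^sub>F z in nhds 0.
        ((\<lambda>(\<alpha>, \<beta>). c \<alpha> \<beta> * (\<Prod>i\<in>UNIV. Re (z $ i) ^ \<alpha> i * Im (z $ i) ^ \<beta> i)) has_sum f z) UNIV)"

text \<open>An element \<open>p / q\<close> of the field of fractions of a ring of germs is given by a pair
  \<open>p, q\<close> of elements of the ring with \<open>q\<close> not the zero germ. The fractions \<open>p / q\<close> and \<open>c / 1\<close> are
  equal iff \<open>p = c q\<close> as germs.\<close>

definition real_meromorphic_germ ::
    "(complex ^ 'n \<Rightarrow> real) \<Rightarrow> (complex ^ 'n \<Rightarrow> real) \<Rightarrow> bool" where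
  "real_meromorphic_germ p q \<longleftrightarrow>
     real_analytic_germ p \<and> real_analytic_germ q \<and> \<not> (\<forall>\<^sub>F z in nhds 0. q z = 0)"

definition meromorphic_germ ::
    "(complex ^ 'n \<Rightarrow> complex) \<Rightarrow> (complex ^ 'n \<Rightarrow> complex) \<Rightarrow> bool" where
  "meromorphic_germ p q \<longleftrightarrow>
     holomorphic_germ p \<and> holomorphic_germ q \<and> \<not> (\<forall>\<^sub>F z in nhds 0. q z = 0)"

definition nonconstant_fraction ::
    "(complex ^ 'n \<Rightarrow> 'k::real_normed_field) \<Rightarrow> (complex ^ 'n \<Rightarrow> 'k) \<Rightarrow> bool" where
  "nonconstant_fraction p q \<longleftrightarrow> \<not> (\<exists>c. \<forall>\<^sub>F z in nhds 0. p z = c * q z)"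

text \<open>Complex-valued differential forms on the real vector space underlying \<open>\<complex>\<^sup>n\<close>: a \<open>k\<close>-form at a
  point is a function of \<open>k\<close> tangent vectors, and a form is a family of these indexed by the
  points.\<close>

definition wedge11 :: "('v \<Rightarrow> complex) \<Rightarrow> ('v \<Rightarrow> complex) \<Rightarrow> 'v \<Rightarrow> 'v \<Rightarrow> complex" where
  "wedge11 \<alpha> \<beta> u v = \<alpha> u * \<beta> v - \<alpha> v * \<beta> u"

definition wedge12 :: "('v \<Rightarrow> complex) \<Rightarrow> ('v \<Rightarrow> 'v \<Rightarrow> complex) \<Rightarrow> 'v \<Rightarrow> 'v \<Rightarrow> 'v \<Rightarrow> complex" where
  "wedge12 \<alpha> \<omega> u v w = \<alpha> u * \<omega> v w - \<alpha> v * \<omega> u w + \<alpha> w * \<omega> u v"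

definition d0 :: "('v::real_normed_vector \<Rightarrow> complex) \<Rightarrow> 'v \<Rightarrow> 'v \<Rightarrow> complex" where
  "d0 f z v = frechet_derivative f (at z) v"

definition d1 :: "('v::real_normed_vector \<Rightarrow> 'v \<Rightarrow> complex) \<Rightarrow> 'v \<Rightarrow> 'v \<Rightarrow> 'v \<Rightarrow> complex" where
  "d1 \<omega> z u v =
     frechet_derivative (\<lambda>x. \<omega> x v) (at z) u - frechet_derivative (\<lambda>x. \<omega> x u) (at z) v"

text \<open>The 1-form \<open>\<Sum>\<^sub>j \<sigma>\<^sub>j dz\<^sub>j\<close> with coefficient vector \<open>\<sigma>\<close>, and its complex conjugate.\<close>

definition form :: "(complex ^ 'n \<Rightarrow> complex ^ 'n) \<Rightarrow> complex ^ 'n \<Rightarrow> complex ^ 'n \<Rightarrow> complex" where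
  "form \<sigma> z v = (\<Sum>j\<in>UNIV. \<sigma> z $ j * v $ j)"

definition form_cnj :: "(complex ^ 'n \<Rightarrow> complex ^ 'n) \<Rightarrow> complex ^ 'n \<Rightarrow> complex ^ 'n \<Rightarrow> complex" where
  "form_cnj \<sigma> z v = cnj (form \<sigma> z v)"

definition germ_dvd :: "(complex ^ 'n \<Rightarrow> complex) \<Rightarrow> (complex ^ 'n \<Rightarrow> complex) \<Rightarrow> bool" where
  "germ_dvd g f \<longleftrightarrow> (\<exists>h. holomorphic_germ h \<and> (\<forall>\<^sub>F z in nhds 0. f z = g z * h z))"

text \<open>The absence of common factors forces \<open>\<sigma>\<close> to be a nonzero germ, since every germ divides \<open>0\<close>.\<close>

definition no_common_factor :: "(complex ^ 'n \<Rightarrow> complex ^ 'n) \<Rightarrow> bool" where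
  "no_common_factor \<sigma> \<longleftrightarrow>
     (\<forall>g. holomorphic_germ g \<longrightarrow> (\<forall>j. germ_dvd g (\<lambda>z. \<sigma> z $ j)) \<longrightarrow> germ_dvd g (\<lambda>_. 1))"

definition foliation_germ :: "(complex ^ 'n \<Rightarrow> complex ^ 'n) \<Rightarrow> bool" where
  "foliation_germ \<sigma> \<longleftrightarrow>
     (\<forall>j. holomorphic_germ (\<lambda>z. \<sigma> z $ j)) \<and>
     no_common_factor \<sigma> \<and>
     (\<forall>\<^sub>F z in nhds 0. \<forall>u v w. wedge12 (form \<sigma> z) (d1 (form \<sigma>) z) u v w = 0)"

text \<open>Tangency \<open>df \<and> \<sigma> \<and> \<sigma>\<^sup>* = 0\<close> of the foliation to the levels of the real function \<open>f = p / q\<close>,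
  where \<open>\<sigma>\<^sup>*\<close> is the conjugate of \<open>\<sigma>\<close>; the equation is imposed where the fraction is defined.\<close>

definition tangent_to_levels ::
    "(complex ^ 'n \<Rightarrow> complex ^ 'n) \<Rightarrow> (complex ^ 'n \<Rightarrow> real) \<Rightarrow> (complex ^ 'n \<Rightarrow> real) \<Rightarrow> bool" where
  "tangent_to_levels \<sigma> p q \<longleftrightarrow>
     (\<forall>\<^sub>F z in nhds 0. q z \<noteq> 0 \<longrightarrow>
        (\<forall>u v w. wedge12 (d0 (\<lambda>x. complex_of_real (p x / q x)) z)
                   (wedge11 (form \<sigma> z) (form_cnj \<sigma> z)) u v w = 0))"

text \<open>The complex function \<open>h = p / q\<close> is constant along the leaves: \<open>dh \<and> \<sigma> = 0\<close>.\<close>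

definition first_integral ::
    "(complex ^ 'n \<Rightarrow> complex ^ 'n) \<Rightarrow> (complex ^ 'n \<Rightarrow> complex) \<Rightarrow> (complex ^ 'n \<Rightarrow> complex) \<Rightarrow> bool" where
  "first_integral \<sigma> p q \<longleftrightarrow>
     (\<forall>\<^sub>F z in nhds 0. q z \<noteq> 0 \<longrightarrow>
        (\<forall>u v. wedge11 (d0 (\<lambda>x. p x / q x) z) (form \<sigma> z) u v = 0))"

text \<open>At a regular point of the foliation the tangent space of the leaf is the kernel of \<open>\<sigma>\<close>, so both
  equations say that the differential vanishes along the leaf.\<close>

lemma form_add: "form \<sigma> z (u + v) = form \<sigma> z u + form \<sigma> z v"
  by (simp add: form_def algebra_simps sum.distrib)

lemma form_scale: "form \<sigma> z (c *s v) = c * form \<sigma> z v"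
  by (simp add: form_def sum_distrib_left mult.left_commute)

lemma form_eq_1_exists:
  assumes "\<sigma> z \<noteq> 0"
  obtains e where "form \<sigma> z e = 1"
proof -
  obtain j where j: "\<sigma> z $ j \<noteq> 0"
    using assms by (auto simp: vec_eq_iff)
  have "form \<sigma> z (axis j (1 / \<sigma> z $ j)) = (\<Sum>i\<in>UNIV. if i = j then 1 else 0)"
    unfolding form_def using j by (intro sum.cong) (auto simp: axis_def)
  then show ?thesis
    using that by simp
qed

lemma wedge_conj_eq_0_iff:
  fixes \<alpha> :: "complex ^ 'n \<Rightarrow> complex"
  assumes "\<sigma> z \<noteq> 0" and "linear \<alpha>"
  shows "(\<forall>u v w. wedge12 \<alpha> (wedge11 (form \<sigma> z) (form_cnj \<sigma> z)) u v w = 0) \<longleftrightarrow>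
         (\<forall>v. form \<sigma> z v = 0 \<longrightarrow> \<alpha> v = 0)"
proof -
  obtain e where e: "form \<sigma> z e = 1"
    using form_eq_1_exists assms(1) by blast
  have "\<alpha> u = 0"
    if *: "\<forall>u v w. wedge12 \<alpha> (wedge11 (form \<sigma> z) (form_cnj \<sigma> z)) u v w = 0"
      and u: "form \<sigma> z u = 0" for u
    using *[rule_format, of u e "\<i> *s e"] u e
    by (simp add: wedge12_def wedge11_def form_cnj_def form_scale)
  moreover have "wedge12 \<alpha> (wedge11 (form \<sigma> z) (form_cnj \<sigma> z)) u v w = 0"
    if *: "\<forall>v. form \<sigma> z v = 0 \<longrightarrow> \<alpha> v = 0" for u v w
  proof -
    define A where "A = (\<alpha> e - \<i> * \<alpha> (\<i> *s e)) / 2"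
    define B where "B = (\<alpha> e + \<i> * \<alpha> (\<i> *s e)) / 2"
    have \<alpha>: "\<alpha> v = A * form \<sigma> z v + B * cnj (form \<sigma> z v)" for v
    proof -
      define s where "s = form \<sigma> z v"
      define v' where "v' = v + (- s) *s e"
      have "form \<sigma> z v' = 0"
        unfolding v'_def form_add form_scale e s_def by simp
      then have "\<alpha> v' = 0"
        using * by blast
      moreover have "v = v' + (Re s *\<^sub>R e + Im s *\<^sub>R (\<i> *s e))"
        by (simp add: v'_def vec_eq_iff complex_eq_iff algebra_simps)
      ultimately have "\<alpha> v = \<alpha> (Re s *\<^sub>R e + Im s *\<^sub>R (\<i> *s e))"
        using linear_add[OF assms(2), of v' "Re s *\<^sub>R e + Im s *\<^sub>R (\<i> *s e)"] by simp
      also have "\<dots> = of_real (Re s) * \<alpha> e + of_real (Im s) * \<alpha> (\<i> *s e)"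
        unfolding linear_add[OF assms(2)] linear_scale[OF assms(2)] by (simp add: scaleR_conv_of_real)
      also have "\<dots> = A * s + B * cnj s"
      proof -
        have s: "of_real (Re s) + \<i> * of_real (Im s) = s"
          and cnj_s: "of_real (Re s) - \<i> * of_real (Im s) = cnj s"
          by (simp_all add: complex_eq_iff)
        have "a * p + b * q = (p - \<i> * q) / 2 * (a + \<i> * b) + (p + \<i> * q) / 2 * (a - \<i> * b)"
          for a b p q :: complex
          by (simp add: field_simps)
        from this[of "of_real (Re s)" "\<alpha> e" "of_real (Im s)" "\<alpha> (\<i> *s e)"]
        show ?thesis
          unfolding s cnj_s A_def B_def .
      qed
      finally show ?thesis
        by (simp add: s_def)
    qed
    have "(A * a + B * a') * (b * c' - c * b') - (A * b + B * b') * (a * c' - c * a') +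
        (A * c + B * c') * (a * b' - b * a') = 0" for a a' b b' c c' :: complex
      by (simp add: algebra_simps)
    then show ?thesis
      unfolding wedge12_def wedge11_def form_cnj_def \<alpha>[of u] \<alpha>[of v] \<alpha>[of w] .
  qed
  ultimately show ?thesis
    by blast
qed

lemma wedge_eq_0_iff:
  fixes \<alpha> :: "complex ^ 'n \<Rightarrow> complex"
  assumes "\<sigma> z \<noteq> 0" and "\<And>c v. \<alpha> (c *s v) = c * \<alpha> v" and "\<And>u v. \<alpha> (u + v) = \<alpha> u + \<alpha> v"
  shows "(\<forall>u v. wedge11 \<alpha> (form \<sigma> z) u v = 0) \<longleftrightarrow> (\<forall>v. form \<sigma> z v = 0 \<longrightarrow> \<alpha> v = 0)"
proof -
  obtain e where e: "form \<sigma> z e = 1"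
    using form_eq_1_exists assms(1) by blast
  have "\<alpha> u = 0"
    if *: "\<forall>u v. wedge11 \<alpha> (form \<sigma> z) u v = 0" and u: "form \<sigma> z u = 0" for u
    using *[rule_format, of u e] u e by (simp add: wedge11_def)
  moreover have "wedge11 \<alpha> (form \<sigma> z) u v = 0"
    if *: "\<forall>v. form \<sigma> z v = 0 \<longrightarrow> \<alpha> v = 0" for u v
  proof -
    have "\<alpha> v = form \<sigma> z v * \<alpha> e" for v
    proof -
      have "form \<sigma> z (v + (- form \<sigma> z v) *s e) = 0"
        unfolding form_add form_scale e by simp
      then have "\<alpha> (v + (- form \<sigma> z v) *s e) = 0"
        using * by blast
      then show ?thesis
        by (simp only: assms(2,3) mult_minus_left add_uminus_conv_diff right_minus_eq)
    qed
    moreover have "x * a * y - y * a * x = 0" for x y a :: complex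
      by simp
    ultimately show ?thesis
      unfolding wedge11_def by metis
  qed
  ultimately show ?thesis
    by blast
qed

end

theory Submission
  imports Defs "HOL-Complex_Analysis.Conformal_Mappings"
begin

text \<open>The power series of \<open>p\<close> and \<open>q\<close> converge for complex values of the real coordinates, so that
  \<open>p z = P z (cnj z)\<close> and \<open>q z = Q z (cnj z)\<close> with \<open>P\<close> and \<open>Q\<close> holomorphic in two independent
  variables \<open>z\<close> and \<open>w\<close>. On the kernel of \<open>\<sigma>\<close>, a complex subspace, the vanishing of the
  differential of \<open>p / q\<close> forces that of its complex linear part, which is the differential of
  \<open>P (\<cdot>, w) / Q (\<cdot>, w)\<close> at \<open>w = cnj z\<close>. The set \<open>w = cnj z\<close> being totally real of maximal dimension, this
  persists for all \<open>(z, w)\<close>. Hence every \<open>P (\<cdot>, w) / Q (\<cdot>, w)\<close> is a first integral, and one of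
  them is not constant because \<open>p / q\<close> is not.\<close>

section \<open>Power series in several complex variables\<close>

definition power_product :: "('m::finite \<Rightarrow> nat) \<Rightarrow> complex ^ 'm \<Rightarrow> complex" where
  "power_product a x = (\<Prod>i\<in>UNIV. x $ i ^ a i)"

text \<open>The differential of a monomial by the Leibniz rule. For \<open>a i = 0\<close> the
  truncated exponent \<open>a i - 1\<close> is harmless, since the factor
  \<open>of_nat (a i)\<close> vanishes.\<close>

definition power_product_deriv :: "('m::finite \<Rightarrow> nat) \<Rightarrow> complex ^ 'm \<Rightarrow> complex ^ 'm \<Rightarrow> complex" where
  "power_product_deriv a x u =
     (\<Sum>i\<in>UNIV. (of_nat (a i) * x $ i ^ (a i - 1) * u $ i) * (\<Prod>j\<in>UNIV - {i}. x $ j ^ a j))"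

lemma has_derivative_power_product:
  "(power_product a has_derivative power_product_deriv a x) (at x within S)"
proof -
  have "((\<lambda>x. x $ i ^ a i) has_derivative (\<lambda>u. of_nat (a i) * x $ i ^ (a i - 1) * u $ i)) (at x within S)"
    for i
    by (rule has_derivative_eq_rhs[OF has_derivative_power
          [OF bounded_linear_imp_has_derivative[OF bounded_linear_vec_nth]]]) (simp add: fun_eq_iff ac_simps)
  then show ?thesis
    unfolding power_product_def[abs_def] power_product_deriv_def[abs_def]
    by (intro has_derivative_prod)
qed

lemma power_product_deriv_scale: "power_product_deriv a x (c *s u) = c * power_product_deriv a x u"
  unfolding power_product_deriv_def by (simp add: sum_distrib_left ac_simps)

lemma norm_power_product_le:
  assumes "\<And>i. norm (x $ i) \<le> r"
  shows "norm (power_product a x) \<le> r ^ (\<Sum>i\<in>UNIV. a i)"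
  unfolding power_product_def prod_norm[symmetric] norm_power power_sum
  by (intro prod_mono) (auto intro!: power_mono assms)

text \<open>Halving the radius absorbs the exponent that differentiation brings down:
  \<open>k * (r / 2) ^ (k - 1)\<close> is at most \<open>2 / r * r ^ k\<close> because k \<le> 2 ^
  k. So a majorant of a series at radius \<open>r\<close> also majorizes its derived series, up to a
  constant independent of the exponents.\<close>

lemma norm_power_product_deriv_le:
  fixes x :: "complex ^ 'm"
  assumes "r > 0" and x: "\<And>i. norm (x $ i) \<le> r / 2"
  shows "norm (power_product_deriv a x u) \<le> real CARD('m) * (2 / r) * r ^ (\<Sum>i\<in>UNIV. a i) * norm u"
proof -
  have one: "real k * (r / 2) ^ (k - 1) \<le> 2 / r * r ^ k" for k
  proof (cases k)
    case (Suc l)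
    have "real k \<le> 2 ^ k"
      using less_exp[of k] by (metis less_imp_le of_nat_le_iff of_nat_numeral of_nat_power)
    then have "real k * r ^ l \<le> 2 ^ k * r ^ l"
      using \<open>r > 0\<close> by (intro mult_right_mono) auto
    then show ?thesis
      using \<open>r > 0\<close> Suc by (simp add: field_simps)
  qed (use \<open>r > 0\<close> in simp)
  have r: "norm (x $ i) \<le> r" for i
    using x[of i] \<open>r > 0\<close> by simp
  have "norm ((of_nat (a i) * x $ i ^ (a i - 1) * u $ i) * (\<Prod>j\<in>UNIV - {i}. x $ j ^ a j)) \<le>
      2 / r * r ^ (\<Sum>i\<in>UNIV. a i) * norm u" for i
  proof -
    have "norm ((of_nat (a i) * x $ i ^ (a i - 1) * u $ i) * (\<Prod>j\<in>UNIV - {i}. x $ j ^ a j)) =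
        (real (a i) * norm (x $ i) ^ (a i - 1) * norm (u $ i)) * (\<Prod>j\<in>UNIV - {i}. norm (x $ j) ^ a j)"
      by (simp add: norm_mult norm_power prod_norm[symmetric])
    also have "\<dots> \<le> (real (a i) * (r / 2) ^ (a i - 1) * norm u) * (\<Prod>j\<in>UNIV - {i}. r ^ a j)"
      using \<open>r > 0\<close>
      by (intro mult_mono power_mono prod_mono prod_nonneg x r component_le_norm_cart conjI) 
        (auto intro!: Finite_Cartesian_Product.norm_nth_le prod_nonneg)
    also have "\<dots> \<le> (2 / r * r ^ a i * norm u) * (\<Prod>j\<in>UNIV - {i}. r ^ a j)"
      using \<open>r > 0\<close> one[of "a i"] by (intro mult_right_mono prod_nonneg) auto
    also have "\<dots> = 2 / r * r ^ (\<Sum>i\<in>UNIV. a i) * norm u"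
      by (simp add: power_sum prod.remove[of UNIV i] ac_simps)
    finally show ?thesis .
  qed
  then have "norm (power_product_deriv a x u) \<le> (\<Sum>i\<in>(UNIV::'m set). 2 / r * r ^ (\<Sum>i\<in>UNIV. a i) * norm u)"
    unfolding power_product_deriv_def by (intro sum_norm_le) simp
  then show ?thesis
    by (simp add: ac_simps)
qed

lemma open_polydisc: "open {x :: complex ^ 'm. \<forall>i. norm (x $ i) < r}"
proof -
  have "{x :: complex ^ 'm. \<forall>i. norm (x $ i) < r} = (\<Inter>i. {x. norm (x $ i) < r})"
    by auto
  moreover have "open (\<Inter>i. {x :: complex ^ 'm. norm (x $ i) < r})"
    by (intro open_INT ballI open_Collect_less continuous_intros) auto
  ultimately show ?thesis
    by simp
qed

lemma convex_polydisc: "convex {x :: complex ^ 'm. \<forall>i. norm (x $ i) < r}"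
proof -
  have "{x :: complex ^ 'm. \<forall>i. norm (x $ i) < r} = (\<Inter>i. (\<lambda>x. x $ i) -` ball 0 r)"
    by (auto simp: dist_norm)
  moreover have "linear (\<lambda>x :: complex ^ 'm. x $ i)" for i
    by (simp add: bounded_linear.linear bounded_linear_vec_nth)
  then have "convex (\<Inter>i. (\<lambda>x :: complex ^ 'm. x $ i) -` ball 0 r)"
    by (intro convex_INT convex_linear_vimage convex_ball)
  ultimately show ?thesis
    by simp
qed

section \<open>Term-by-term differentiation of dominated power series\<close>

context
  fixes c :: "nat \<Rightarrow> complex" and a :: "nat \<Rightarrow> 'm::finite \<Rightarrow> nat" and r :: real
  assumes r: "r > 0" and summ: "summable (\<lambda>k. norm (c k) * r ^ (\<Sum>i\<in>UNIV. a k i))"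
begin

private definition "C = real CARD('m) * (2 / r)"

private lemma C: "C \<ge> 0"
  using r by (simp add: C_def)

lemma power_series_bound:
  assumes "\<And>i. norm (x $ i) < r / 2"
  shows "norm (c k * power_product (a k) x) \<le> norm (c k) * r ^ (\<Sum>i\<in>UNIV. a k i)"
proof -
  have "norm (x $ i) \<le> r" for i
    using assms[of i] r by simp
  then show ?thesis
    unfolding norm_mult by (intro mult_left_mono norm_power_product_le) auto
qed

private lemma deriv_bound:
  assumes "\<And>i. norm (x $ i) < r / 2"
  shows "norm (c k * power_product_deriv (a k) x u) \<le>
           norm (c k) * r ^ (\<Sum>i\<in>UNIV. a k i) * (C * norm u)"
proof -
  have "norm (power_product_deriv (a k) x u) \<le> C * r ^ (\<Sum>i\<in>UNIV. a k i) * norm u"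
    unfolding C_def using r assms by (intro norm_power_product_deriv_le) (auto intro: less_imp_le)
  from mult_left_mono[OF this, of "norm (c k)"] show ?thesis
    by (simp add: norm_mult ac_simps)
qed

lemma power_series_sums:
  assumes "\<And>i. norm (x $ i) < r / 2"
  shows "(\<lambda>k. c k * power_product (a k) x) sums (\<Sum>k. c k * power_product (a k) x)"
  by (intro summable_sums summable_comparison_test'[OF summ, of 0] power_series_bound assms)

lemma power_series_deriv_sums:
  assumes "\<And>i. norm (x $ i) < r / 2"
  shows "(\<lambda>k. c k * power_product_deriv (a k) x u) sums (\<Sum>k. c k * power_product_deriv (a k) x u)"
  by (rule summable_sums, rule summable_comparison_test'[OF summable_mult2[OF summ], of 0],
      rule deriv_bound[OF assms])

lemma power_series_deriv_scale:
  assumes "\<And>i. norm (x $ i) < r / 2"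
  shows "(\<Sum>k. c k * power_product_deriv (a k) x (b *s u)) = b * (\<Sum>k. c k * power_product_deriv (a k) x u)"
  using sums_mult[OF power_series_deriv_sums[OF assms], of b]
  by (simp add: power_product_deriv_scale ac_simps sums_iff)

text \<open>The error is a tail of the derived series, dominated by the same tail of the majorant
  times \<open>C * norm h\<close>. The bound does not depend on \<open>x\<close>, which is the
  uniformity that \<open>has_derivative_series\<close> asks for.\<close>

private lemma deriv_tail_bound:
  fixes x :: "complex ^ 'm"
  assumes n: "(\<Sum>k. norm (c (k + n)) * r ^ (\<Sum>i\<in>UNIV. a (k + n) i)) * C < e"
    and x: "\<And>i. norm (x $ i) < r / 2"
  shows "norm ((\<Sum>k<n. c k * power_product_deriv (a k) x h) -
    (\<Sum>k. c k * power_product_deriv (a k) x h)) \<le> e * norm h"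
proof -
  let ?M = "\<lambda>k. norm (c k) * r ^ (\<Sum>i\<in>UNIV. a k i)"
  have s: "summable (\<lambda>k. ?M (k + n) * (C * norm h))"
    by (rule summable_mult2[OF summable_ignore_initial_segment[OF summ]])
  have "norm ((\<Sum>k<n. c k * power_product_deriv (a k) x h) - (\<Sum>k. c k * power_product_deriv (a k) x h))
      = norm ((\<Sum>k. c k * power_product_deriv (a k) x h) - (\<Sum>k<n. c k * power_product_deriv (a k) x h))"
    by (rule norm_minus_commute)
  also have "\<dots> = norm (\<Sum>k. c (k + n) * power_product_deriv (a (k + n)) x h)"
    unfolding suminf_minus_initial_segment[OF sums_summable[OF power_series_deriv_sums[OF x]]] ..
  also have "\<dots> \<le> (\<Sum>k. ?M (k + n) * (C * norm h))"
    by (rule norm_suminf_le[OF _ s]) (rule deriv_bound[OF x])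
  also have "\<dots> = (\<Sum>k. ?M (k + n)) * (C * norm h)"
    by (rule suminf_mult2[symmetric, OF summable_ignore_initial_segment[OF summ]])
  also have "\<dots> \<le> e * norm h"
    using mult_right_mono[OF less_imp_le[OF n], of "norm h"] by (simp add: ac_simps)
  finally show "norm ((\<Sum>k<n. c k * power_product_deriv (a k) x h) -
      (\<Sum>k. c k * power_product_deriv (a k) x h)) \<le> e * norm h" .
qed

lemma power_series_has_derivative:
  assumes x: "\<And>i. norm (x $ i) < r / 2"
  shows "((\<lambda>x. \<Sum>k. c k * power_product (a k) x) has_derivative
          (\<lambda>u. \<Sum>k. c k * power_product_deriv (a k) x u)) (at x)"
proof -
  let ?S = "{x :: complex ^ 'm. \<forall>i. norm (x $ i) < r / 2}"
  let ?M = "\<lambda>k. norm (c k) * r ^ (\<Sum>i\<in>UNIV. a k i)"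
  have "\<exists>g. \<forall>x\<in>?S. (\<lambda>k. c k * power_product (a k) x) sums (g x) \<and>
      (g has_derivative (\<lambda>u. \<Sum>k. c k * power_product_deriv (a k) x u)) (at x within ?S)"
  proof (rule has_derivative_series[OF convex_polydisc])
    show "((\<lambda>x. c n * power_product (a n) x) has_derivative (\<lambda>u. c n * power_product_deriv (a n) x u))
        (at x within ?S)" for n x
      by (rule has_derivative_mult_right[OF has_derivative_power_product])
    show "\<forall>\<^sub>F n in sequentially. \<forall>x\<in>?S. \<forall>h.
        norm ((\<Sum>k<n. c k * power_product_deriv (a k) x h) - (\<Sum>k. c k * power_product_deriv (a k) x h))
          \<le> e * norm h" if "e > 0" for e
    proof -
      have "(\<lambda>n. (\<Sum>k. ?M (k + n)) * C) \<longlonglongrightarrow> 0 * C"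
        by (rule tendsto_mult_right[OF suminf_exist_split2[OF summ]])
      then have ev: "\<forall>\<^sub>F n in sequentially. (\<Sum>k. ?M (k + n)) * C < e"
        by (rule order_tendstoD(2)) (use \<open>e > 0\<close> in simp)
      show ?thesis
        by (rule eventually_mono[OF ev], intro ballI allI, rule deriv_tail_bound) blast+
    qed
    \<comment> \<open>Uniform convergence of the derivatives needs one point where the series itself
      converges; \<open>x\<close> serves.\<close>
    show "x \<in> ?S"
      using x by blast
    show "(\<lambda>k. c k * power_product (a k) x) sums (\<Sum>k. c k * power_product (a k) x)"
      by (rule power_series_sums[OF x])
  qed
  then obtain g where g: "\<And>x. x \<in> ?S \<Longrightarrow> (\<lambda>k. c k * power_product (a k) x) sums (g x)"
    "\<And>x. x \<in> ?S \<Longrightarrow> (g has_derivative (\<lambda>u. \<Sum>k. c k * power_product_deriv (a k) x u)) (at x within ?S)"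
    by blast
  \<comment> \<open>The series theorem yields only some limit function \<open>g\<close>; uniqueness
    of sums identifies it with the given series on the open polydisc.\<close>
  have S: "x \<in> ?S"
    using x by blast
  have "(g has_derivative (\<lambda>u. \<Sum>k. c k * power_product_deriv (a k) x u)) (at x)"
    using g(2)[OF S] unfolding at_within_open[OF S open_polydisc] .
  then show ?thesis
    by (rule has_derivative_transform_within_open[OF _ open_polydisc S]) (rule sums_unique[OF g(1)])
qed

text \<open>The partial sums are polynomials in the coordinates of \<open>g\<close>, and the
  majorant gives uniform convergence by the Weierstrass test. The intended \<open>g\<close> are
  parametrized complex lines.\<close>

lemma power_series_holomorphic_on:
  assumes "open T" and "\<And>i. (\<lambda>t. g t $ i) holomorphic_on T" and "\<And>t i. t \<in> T \<Longrightarrow> norm (g t $ i) < r / 2"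
  shows "(\<lambda>t. \<Sum>k. c k * power_product (a k) (g t)) holomorphic_on T"
proof (rule holomorphic_uniform_sequence[OF assms(1)])
  show "(\<lambda>t. \<Sum>k<n. c k * power_product (a k) (g t)) holomorphic_on T" for n
    unfolding power_product_def by (intro holomorphic_intros assms)
  fix t assume "t \<in> T"
  then obtain d where d: "d > 0" "cball t d \<subseteq> T"
    using assms(1) open_contains_cball by blast
  have "uniform_limit (cball t d) (\<lambda>n t. \<Sum>k<n. c k * power_product (a k) (g t))
      (\<lambda>t. \<Sum>k. c k * power_product (a k) (g t)) sequentially"
    by (rule Weierstrass_m_test[OF _ summ]) (rule power_series_bound, use d assms(3) in blast)
  then show "\<exists>d>0. cball t d \<subseteq> T \<and> uniform_limit (cball t d) (\<lambda>n t. \<Sum>k<n. c k * power_product (a k) (g t))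
      (\<lambda>t. \<Sum>k. c k * power_product (a k) (g t)) sequentially"
    using d by blast
qed

lemma power_series_deriv_holomorphic_on:
  assumes "open T" and "\<And>i. (\<lambda>t. g t $ i) holomorphic_on T" and "\<And>t i. t \<in> T \<Longrightarrow> norm (g t $ i) < r / 2"
  shows "(\<lambda>t. \<Sum>k. c k * power_product_deriv (a k) (g t) u) holomorphic_on T"
proof (rule holomorphic_uniform_sequence[OF assms(1)])
  show "(\<lambda>t. \<Sum>k<n. c k * power_product_deriv (a k) (g t) u) holomorphic_on T" for n
    unfolding power_product_deriv_def by (intro holomorphic_intros assms)
  fix t assume "t \<in> T"
  then obtain d where d: "d > 0" "cball t d \<subseteq> T"
    using assms(1) open_contains_cball by blast
  have "uniform_limit (cball t d) (\<lambda>n t. \<Sum>k<n. c k * power_product_deriv (a k) (g t) u)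
      (\<lambda>t. \<Sum>k. c k * power_product_deriv (a k) (g t) u) sequentially"
    by (rule Weierstrass_m_test[OF _ summable_mult2[OF summ]]) (rule deriv_bound, use d assms(3) in blast)
  then show "\<exists>d>0. cball t d \<subseteq> T \<and> uniform_limit (cball t d) (\<lambda>n t. \<Sum>k<n. c k * power_product_deriv (a k) (g t) u)
      (\<lambda>t. \<Sum>k. c k * power_product_deriv (a k) (g t) u) sequentially"
    using d by blast
qed

end

section \<open>Holomorphy along complex lines\<close>

definition cnj_vec :: "complex ^ 'n \<Rightarrow> complex ^ 'n" where
  "cnj_vec z = (\<chi> j. cnj (z $ j))"

lemma cnj_vec_nth [simp]: "cnj_vec z $ j = cnj (z $ j)"
  by (simp add: cnj_vec_def)

lemma norm_cnj_vec [simp]: "norm (cnj_vec z) = norm z"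
  by (simp add: norm_vec_def)

lemma cnj_vec_add: "cnj_vec (z + w) = cnj_vec z + cnj_vec w"
  and cnj_vec_diff: "cnj_vec (z - w) = cnj_vec z - cnj_vec w"
  and cnj_vec_scale: "cnj_vec (c *s z) = cnj c *s cnj_vec z"
  and cnj_vec_cnj_vec [simp]: "cnj_vec (cnj_vec z) = z"
  by (simp_all add: vec_eq_iff)

lemma scaleR_eq_scale: "r *\<^sub>R (z :: complex ^ 'n) = of_real r *s z"
  by (simp add: vec_eq_iff scaleR_conv_of_real[symmetric])

text \<open>Holomorphy in the pair (z, w) is recorded only through restrictions to complex lines of
  the product space, since every extension argument below is the one-variable identity theorem on
  such a line.\<close>

definition line_holomorphic ::
    "real \<Rightarrow> (complex ^ 'n \<Rightarrow> complex ^ 'n \<Rightarrow> complex) \<Rightarrow> bool" where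
  "line_holomorphic r H \<longleftrightarrow>
     (\<forall>a b a' b'. (\<lambda>t. H (a + t *s b) (a' + t *s b')) holomorphic_on
        {t. norm (a + t *s b) < r \<and> norm (a' + t *s b') < r})"

lemma line_holomorphicD:
  "line_holomorphic r H \<Longrightarrow> (\<lambda>t. H (a + t *s b) (a' + t *s b')) holomorphic_on
     {t. norm (a + t *s b) < r \<and> norm (a' + t *s b') < r}"
  by (simp add: line_holomorphic_def)

lemma line_holomorphic_mono:
  assumes "line_holomorphic r H" "s \<le> r"
  shows "line_holomorphic s H"
  unfolding line_holomorphic_def
  using assms by (intro allI holomorphic_on_subset[OF line_holomorphicD[OF assms(1)]]) auto

lemma line_holomorphic_const: "line_holomorphic r (\<lambda>z w. c)"
  by (simp add: line_holomorphic_def)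

lemma line_holomorphic_mult:
  "line_holomorphic r G \<Longrightarrow> line_holomorphic r H \<Longrightarrow> line_holomorphic r (\<lambda>z w. G z w * H z w)"
  by (simp add: line_holomorphic_def holomorphic_on_mult)

lemma line_holomorphic_diff:
  "line_holomorphic r G \<Longrightarrow> line_holomorphic r H \<Longrightarrow> line_holomorphic r (\<lambda>z w. G z w - H z w)"
  by (simp add: line_holomorphic_def holomorphic_on_diff)

text \<open>The parameter set is an intersection of preimages of balls under linear maps. Convexity
  makes it connected, as analytic continuation requires.\<close>

lemma open_line: "open {t. norm (a + t *s b) < r \<and> norm (a' + t *s b') < r}"
  and convex_line: "convex {t. norm (a + t *s b) < r \<and> norm (a' + t *s b') < r}"
  for a b a' b' :: "complex ^ 'n"
proof -
  let ?l = "\<lambda>b :: complex ^ 'n. \<lambda>t. t *s b"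
  have lin: "linear (?l b)" for b
    by (intro linearI) (simp_all add: vec_eq_iff algebra_simps)
  have eq: "{t. norm (a + t *s b) < r \<and> norm (a' + t *s b') < r} =
      ?l b -` ball (- a) r \<inter> ?l b' -` ball (- a') r"
    by (auto simp: dist_norm norm_minus_commute[of "- _"] add.commute)
  show "convex {t. norm (a + t *s b) < r \<and> norm (a' + t *s b') < r}"
    unfolding eq by (intro convex_Int convex_linear_vimage lin convex_ball)
  show "open {t. norm (a + t *s b) < r \<and> norm (a' + t *s b') < r}"
    unfolding eq
    by (intro open_Int open_vimage open_ball linear_continuous_on lin[unfolded linear_conv_bounded_linear])
qed

section \<open>Identity principles along complex lines\<close>

lemma line_holomorphic_eq_0:
  assumes "line_holomorphic r H"
    and "norm (a + t0 *s b) < r" "norm (a' + t0 *s b') < r" "t0 islimpt U"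
    and "\<And>t. t \<in> U \<Longrightarrow> norm (a + t *s b) < r \<and> norm (a' + t *s b') < r \<and> H (a + t *s b) (a' + t *s b') = 0"
    and "norm (a + t1 *s b) < r" "norm (a' + t1 *s b') < r"
  shows "H (a + t1 *s b) (a' + t1 *s b') = 0"
  by (rule analytic_continuation[OF line_holomorphicD[OF assms(1), of a b a' b'] open_line
        convex_connected[OF convex_line], where U = U and \<xi> = t0])
    (use assms in auto)

lemma islimpt_complex_of_real_greaterThanLessThan:
  assumes "0 < d"
  shows "0 islimpt (complex_of_real ` {0<..<d})"
  unfolding islimpt_approachable
proof (intro allI impI)
  fix e :: real assume "e > 0"
  then have "min d e / 2 \<in> {0<..<d}" "\<bar>min d e / 2\<bar> < e" "min d e / 2 \<noteq> 0"
    using assms by auto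
  then have "of_real (min d e / 2) \<in> complex_of_real ` {0<..<d}"
    "norm (complex_of_real (min d e / 2)) < e" "of_real (min d e / 2) \<noteq> (0 :: complex)"
    by (auto simp only: norm_of_real of_real_eq_0_iff)
  then show "\<exists>x'\<in>complex_of_real ` {0<..<d}. x' \<noteq> 0 \<and> dist x' 0 < e"
    by (metis dist_0_norm dist_commute)
qed

text \<open>Small positive reals accumulate at the parameter 0, so zeros there already force
  vanishing on the whole connected slice, including at non-real parameters.\<close>

lemma line_holomorphic_vanishing_segment:
  assumes H: "line_holomorphic r H"
    and a: "norm a < r" "norm a' < r"
    and ev: "\<forall>\<^sub>F t in at_right 0. H (a + of_real t *s b) (a' + of_real t *s b') = 0"
    and t1: "norm (a + t1 *s b) < r" "norm (a' + t1 *s b') < r"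
  shows "H (a + t1 *s b) (a' + t1 *s b') = 0"
proof -
  let ?S = "{t. norm (a + t *s b) < r \<and> norm (a' + t *s b') < r}"
  have "0 \<in> ?S" using a by simp
  then obtain e where e: "e > 0" "ball 0 e \<subseteq> ?S"
    using open_line[of a b r a' b'] open_contains_ball by blast
  obtain d where d: "d > 0" "\<And>t. 0 < t \<Longrightarrow> t < d \<Longrightarrow> H (a + of_real t *s b) (a' + of_real t *s b') = 0"
    using ev unfolding eventually_at_right_field by blast
  have m: "0 < min d e" using d e by simp
  show ?thesis
  proof (rule line_holomorphic_eq_0[OF H _ _ islimpt_complex_of_real_greaterThanLessThan[OF m] _ t1])
    fix t assume "t \<in> complex_of_real ` {0<..<min d e}"
    then obtain s where s: "t = of_real s" "0 < s" "s < d" "s < e" by auto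
    then have "t \<in> ?S" using e(2) by (auto simp: subset_iff dist_norm)
    then show "norm (a + t *s b) < r \<and> norm (a' + t *s b') < r \<and> H (a + t *s b) (a' + t *s b') = 0"
      using s d(2) by auto
  qed (use a in auto)
qed

text \<open>Along the complex line \<open>t \<mapsto> (a + t b, cnj a + t cnj b)\<close> the real parameters give points of the
  totally real subspace \<open>w = cnj z\<close>, and every point \<open>(z, w)\<close> is reached at \<open>t = \<i>\<close> by a suitable
  choice of \<open>a\<close> and \<open>b\<close>.\<close>

lemma line_holomorphic_vanishing_totally_real:
  assumes H: "line_holomorphic r H" and 0: "\<And>z. norm z < r \<Longrightarrow> H z (cnj_vec z) = 0"
    and zw: "norm z < r" "norm w < r"
  shows "H z w = 0"
proof -
  define a where "a = (1 / 2) *s (z + cnj_vec w)"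
  define b where "b = (1 / (2 * \<i>)) *s (z - cnj_vec w)"
  have z: "a + \<i> *s b = z" and w: "cnj_vec a + \<i> *s cnj_vec b = w"
    by (simp_all add: a_def b_def vec_eq_iff field_simps)
  \<comment> \<open>\<open>a\<close> is the midpoint of \<open>z\<close> and
    \<open>cnj_vec w\<close>, so it stays in the ball and the parameter 0 belongs to the slice.
    Nearby real parameters then give points where the hypothesis applies.\<close>
  have "norm a = norm ((1 / 2) *\<^sub>R (z + cnj_vec w))"
    by (simp add: a_def scaleR_eq_scale)
  also have "\<dots> < r"
    using norm_triangle_ineq[of z "cnj_vec w"] zw by simp
  finally have a: "norm a < r" .
  have "0 \<in> {t. norm (a + t *s b) < r \<and> norm (a + t *s b) < r}" using a by simp
  then obtain e where e: "e > 0" "ball 0 e \<subseteq> {t. norm (a + t *s b) < r \<and> norm (a + t *s b) < r}"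
    using open_line[of a b r a b] open_contains_ball by blast
  have "H (a + of_real t *s b) (cnj_vec a + of_real t *s cnj_vec b) = 0" if "0 < t" "t < e" for t
  proof -
    have "of_real t \<in> ball (0::complex) e" using that by (simp add: dist_norm)
    then have "norm (a + of_real t *s b) < r" using e by blast
    from 0[OF this] show ?thesis by (simp add: cnj_vec_add cnj_vec_scale)
  qed
  then have "\<forall>\<^sub>F t in at_right 0. H (a + of_real t *s b) (cnj_vec a + of_real t *s cnj_vec b) = 0"
    using e(1) unfolding eventually_at_right_field by blast
  from line_holomorphic_vanishing_segment[OF H a _ this, of \<i>] show ?thesis
    using a zw by (simp add: z w)
qed

section \<open>Complexification of real analytic germs\<close>

text \<open>These are the formulas for Re z and Im z in terms of z and its conjugate, with the
  conjugate replaced by an independent \<open>w\<close>. The left summand of the index type carries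
  real parts, the right one imaginary parts.\<close>

definition real_imag_coords :: "complex ^ 'n \<Rightarrow> complex ^ 'n \<Rightarrow> complex ^ ('n + 'n)" where
  "real_imag_coords z w =
     (\<chi> i. case i of Inl j \<Rightarrow> (z $ j + w $ j) / 2 | Inr j \<Rightarrow> (z $ j - w $ j) / (2 * \<i>))"

lemma real_imag_coords_nth [simp]:
  "real_imag_coords z w $ Inl j = (z $ j + w $ j) / 2"
  "real_imag_coords z w $ Inr j = (z $ j - w $ j) / (2 * \<i>)"
  by (simp_all add: real_imag_coords_def)

lemma real_imag_coords_cnj:
  "real_imag_coords z (cnj_vec z) $ Inl j = of_real (Re (z $ j))"
  "real_imag_coords z (cnj_vec z) $ Inr j = of_real (Im (z $ j))"
  by (simp_all add: complex_eq_iff)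

lemma norm_real_imag_coords_less:
  assumes "norm z < r" "norm w < r"
  shows "norm (real_imag_coords z w $ i) < r"
proof -
  have *: "norm (z $ j) < r" "norm (w $ j) < r" for j
    using assms Finite_Cartesian_Product.norm_nth_le order.strict_trans1 by blast+
  show ?thesis
  proof (cases i)
    case (Inl j)
    then show ?thesis
      using *[of j] norm_triangle_ineq[of "z $ j" "w $ j"] by (simp add: norm_divide)
  next
    case (Inr j)
    then show ?thesis
      using *[of j] norm_triangle_ineq4[of "z $ j" "w $ j"] by (simp add: norm_divide norm_mult)
  qed
qed

lemma real_imag_coords_add:
  "real_imag_coords (z + z') (w + w') = real_imag_coords z w + real_imag_coords z' w'"
proof -
  have "real_imag_coords (z + z') (w + w') $ i = (real_imag_coords z w + real_imag_coords z' w') $ i" for i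
    by (cases i) (simp_all add: field_simps)
  then show ?thesis
    by (simp add: vec_eq_iff)
qed

lemma real_imag_coords_scale:
  "real_imag_coords (c *s z) (c *s w) = c *s real_imag_coords z w"
proof -
  have "real_imag_coords (c *s z) (c *s w) $ i = (c *s real_imag_coords z w) $ i" for i
    by (cases i) (simp_all add: field_simps)
  then show ?thesis
    by (simp add: vec_eq_iff)
qed

lemma bounded_linear_real_imag_coords:
  "bounded_linear (\<lambda>z :: complex ^ 'n. real_imag_coords z 0)"
  "bounded_linear (\<lambda>z :: complex ^ 'n. real_imag_coords z (cnj_vec z))"
proof -
  have "linear (\<lambda>z :: complex ^ 'n. real_imag_coords z 0)"
    using real_imag_coords_add[where w = "0 :: complex ^ 'n" and w' = 0]
      real_imag_coords_scale[where w = "0 :: complex ^ 'n"]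
    by (intro linearI) (simp_all add: scaleR_eq_scale)
  moreover have "linear (\<lambda>z :: complex ^ 'n. real_imag_coords z (cnj_vec z))"
    by (intro linearI)
      (simp_all add: scaleR_eq_scale cnj_vec_add cnj_vec_scale real_imag_coords_add real_imag_coords_scale)
  ultimately show "bounded_linear (\<lambda>z :: complex ^ 'n. real_imag_coords z 0)"
    "bounded_linear (\<lambda>z :: complex ^ 'n. real_imag_coords z (cnj_vec z))"
    by (simp_all add: linear_conv_bounded_linear)
qed

text \<open>\<open>P z w\<close> is the holomorphic extension of \<open>f\<close> in which \<open>w\<close> stands for \<open>cnj z\<close>, and \<open>P' z w\<close> is its
  differential in \<open>z\<close>. The symmetry of \<open>P\<close> expresses that \<open>f\<close> is real, and \<open>B\<close> is the antilinear part
  of the differential of \<open>f\<close>.\<close>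

definition complexifies ::
    "real \<Rightarrow> (complex ^ 'n \<Rightarrow> real) \<Rightarrow> (complex ^ 'n \<Rightarrow> complex ^ 'n \<Rightarrow> complex) \<Rightarrow>
     (complex ^ 'n \<Rightarrow> complex ^ 'n \<Rightarrow> complex ^ 'n \<Rightarrow> complex) \<Rightarrow> bool" where
  "complexifies r f P P' \<longleftrightarrow>
     (\<forall>z w. norm z < r \<longrightarrow> norm w < r \<longrightarrow>
        ((\<lambda>x. P x w) has_derivative P' z w) (at z) \<and> (\<forall>c v. P' z w (c *s v) = c * P' z w v) \<and>
        P z w = cnj (P (cnj_vec w) (cnj_vec z))) \<and>
     (\<forall>z. norm z < r \<longrightarrow>
        P z (cnj_vec z) = of_real (f z) \<and>
        (\<exists>B. ((\<lambda>x. complex_of_real (f x)) has_derivative (\<lambda>v. P' z (cnj_vec z) v + B v)) (at z) \<and>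
             (\<forall>v. B (\<i> *s v) = - \<i> * B v))) \<and>
     line_holomorphic r P \<and> (\<forall>u. line_holomorphic r (\<lambda>z w. P' z w u))"

lemma complexifies_mono: "complexifies r f P P' \<Longrightarrow> s \<le> r \<Longrightarrow> complexifies s f P P'"
  unfolding complexifies_def using line_holomorphic_mono by (smt (verit, best))

lemma complexifies_line_holomorphic: "complexifies r f P P' \<Longrightarrow> line_holomorphic r P"
  by (simp add: complexifies_def)

lemma complexifies_diag:
  "complexifies r f P P' \<Longrightarrow> norm z < r \<Longrightarrow> P z (cnj_vec z) = of_real (f z)"
  unfolding complexifies_def by blast

section \<open>From a real power series to its complexification\<close>

lemma prod_UNIV_sum_type:
  fixes f :: "'a::finite + 'b::finite \<Rightarrow> 'c::comm_monoid_mult"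
  shows "(\<Prod>i\<in>UNIV. f i) = (\<Prod>i\<in>UNIV. f (Inl i)) * (\<Prod>i\<in>UNIV. f (Inr i))"
  using prod.Plus[of UNIV UNIV f] by (simp add: comp_def)

text \<open>An unordered sum may be enumerated by the naturals. Evaluating it at a point whose real
  coordinates all equal \<open>r\<close> turns each monomial into \<open>r\<close> to its total
  degree, and real summability is absolute, which gives the majorant.\<close>

lemma real_analytic_germ_has_sum:
  fixes f :: "complex ^ 'n \<Rightarrow> real"
  assumes "real_analytic_germ f"
  obtains c :: "nat \<Rightarrow> real" and a :: "nat \<Rightarrow> 'n + 'n \<Rightarrow> nat" and r where
    "r > 0" "summable (\<lambda>k. norm (complex_of_real (c k)) * r ^ (\<Sum>i\<in>UNIV. a k i))"
    "\<forall>z. norm z < r \<longrightarrow>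
       (\<lambda>k. of_real (c k) * power_product (a k) (real_imag_coords z (cnj_vec z))) sums of_real (f z)"
proof -
  obtain C where "\<forall>\<^sub>F z in nhds 0. ((\<lambda>(\<alpha>, \<beta>). C \<alpha> \<beta> *
      (\<Prod>i\<in>UNIV. Re (z $ i) ^ \<alpha> i * Im (z $ i) ^ \<beta> i)) has_sum f z) (UNIV :: (('n \<Rightarrow> nat) \<times> ('n \<Rightarrow> nat)) set)"
    using assms unfolding real_analytic_germ_def by blast
  then obtain d where "d > 0" and d': "\<And>z. dist z 0 < d \<Longrightarrow> ((\<lambda>(\<alpha>, \<beta>). C \<alpha> \<beta> *
      (\<Prod>i\<in>UNIV. Re (z $ i) ^ \<alpha> i * Im (z $ i) ^ \<beta> i)) has_sum f z) (UNIV :: (('n \<Rightarrow> nat) \<times> ('n \<Rightarrow> nat)) set)"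
    unfolding eventually_nhds_metric by blast
  note d = d'[unfolded dist_0_norm dist_commute[of _ 0]]
  \<comment> \<open>The pairs of exponents form a countably infinite set, hence are in bijection
    with the naturals.\<close>
  have "infinite (UNIV :: ('n \<Rightarrow> nat) set)"
    using finite_fun_UNIVD2[where 'a = 'n and 'b = nat] by auto
  then have inf: "infinite (UNIV :: (('n \<Rightarrow> nat) \<times> ('n \<Rightarrow> nat)) set)"
    by (simp add: finite_prod)
  define e where "e = from_nat_into (UNIV :: (('n \<Rightarrow> nat) \<times> ('n \<Rightarrow> nat)) set)"
  have e: "bij_betw e UNIV UNIV"
    unfolding e_def using inf by (intro bij_betw_from_nat_into) auto
  define c where "c k = (case e k of (\<alpha>, \<beta>) \<Rightarrow> C \<alpha> \<beta>)" for k
  define a where "a k = case_sum (fst (e k)) (snd (e k))" for k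
  have hs: "((\<lambda>k. c k * ((\<Prod>i\<in>UNIV. Re (z $ i) ^ a k (Inl i)) * (\<Prod>i\<in>UNIV. Im (z $ i) ^ a k (Inr i))))
      has_sum f z) UNIV" if "norm z < d" for z
  proof -
    have "((\<lambda>k. (\<lambda>(\<alpha>, \<beta>). C \<alpha> \<beta> * (\<Prod>i\<in>UNIV. Re (z $ i) ^ \<alpha> i * Im (z $ i) ^ \<beta> i)) (e k)) has_sum f z) UNIV"
      using d[OF that] has_sum_reindex_bij_betw[OF e] by blast
    then show ?thesis
      by (simp add: c_def a_def case_prod_beta prod.distrib)
  qed
  \<comment> \<open>All real coordinates of \<open>v\<close> are 1. The 1 in the denominator of
    \<open>r\<close> keeps \<open>r\<close> positive and below \<open>d\<close> even while
    \<open>r\<close> times \<open>v\<close> stays strictly inside the ball of convergence.\<close>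
  define v :: "complex ^ 'n" where "v = (\<chi> i. Complex 1 1)"
  define r where "r = d / (1 + norm v)"
  have m: "1 + norm v > 0"
    using norm_ge_zero[of v] by linarith
  have rd: "r * (1 + norm v) = d" and r0: "r > 0"
    using m \<open>d > 0\<close> by (simp_all add: r_def)
  have "r * norm v \<ge> 0" "norm (r *\<^sub>R v) = r * norm v"
    using r0 by simp_all
  then have r: "r > 0" "r \<le> d" "norm (r *\<^sub>R v) < d"
    using rd r0 unfolding distrib_left by linarith+
  show ?thesis
  proof (rule that[OF r(1)], safe)
    have eq: "(\<Prod>i\<in>UNIV. Re ((r *\<^sub>R v) $ i) ^ a k (Inl i)) * (\<Prod>i\<in>UNIV. Im ((r *\<^sub>R v) $ i) ^ a k (Inr i)) =
        r ^ (\<Sum>i\<in>UNIV. a k i)" for k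
      by (simp add: v_def power_sum prod_UNIV_sum_type)
    have "(\<lambda>k. c k * r ^ (\<Sum>i\<in>UNIV. a k i)) summable_on UNIV"
      using has_sum_imp_summable[OF hs[OF r(3)]] unfolding eq .
    then have "(\<lambda>k. norm (c k * r ^ (\<Sum>i\<in>UNIV. a k i))) summable_on UNIV"
      by (rule summable_on_iff_abs_summable_on_real[THEN iffD1])
    then have "summable (\<lambda>k. norm (c k * r ^ (\<Sum>i\<in>UNIV. a k i)))"
      by (rule summable_on_imp_summable)
    then show "summable (\<lambda>k. norm (complex_of_real (c k)) * r ^ (\<Sum>i\<in>UNIV. a k i))"
      using r(1) by (simp add: abs_mult)
    fix z :: "complex ^ 'n" assume "norm z < r"
    then have "norm z < d"
      using r(2) by linarith
    from has_sum_imp_sums[OF hs[OF this]]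
    have "(\<lambda>k. c k * ((\<Prod>i\<in>UNIV. Re (z $ i) ^ a k (Inl i)) * (\<Prod>i\<in>UNIV. Im (z $ i) ^ a k (Inr i)))) sums f z" .
    from sums_of_real[OF this, where 'a = complex]
    show "(\<lambda>k. of_real (c k) * power_product (a k) (real_imag_coords z (cnj_vec z))) sums of_real (f z)"
      by (simp add: power_product_def prod_UNIV_sum_type real_imag_coords_cnj del: real_imag_coords_nth)
  qed
qed

text \<open>The complexification substitutes \<open>real_imag_coords z w\<close> into the power
  series. The final radius is \<open>r / 2\<close> because term-by-term differentiation is available
  only there.\<close>

lemma real_analytic_germ_complexifies:
  fixes f :: "complex ^ 'n \<Rightarrow> real"
  assumes "real_analytic_germ f"
  obtains r P P' where "r > 0" "complexifies r f P P'"
proof -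
  obtain c :: "nat \<Rightarrow> real" and a :: "nat \<Rightarrow> 'n + 'n \<Rightarrow> nat" and r where r: "r > 0"
    and summ: "summable (\<lambda>k. norm (complex_of_real (c k)) * r ^ (\<Sum>i\<in>UNIV. a k i))"
    and f: "\<forall>z. norm z < r \<longrightarrow>
       (\<lambda>k. of_real (c k) * power_product (a k) (real_imag_coords z (cnj_vec z))) sums of_real (f z)"
    by (rule real_analytic_germ_has_sum[OF assms]) (rule that)
  let ?rho = real_imag_coords
  define F where "F x = (\<Sum>k. of_real (c k) * power_product (a k) x)" for x
  define F' where "F' x u = (\<Sum>k. of_real (c k) * power_product_deriv (a k) x u)" for x u
  define P where "P z w = F (?rho z w)" for z w :: "complex ^ 'n"
  define P' where "P' z w u = F' (?rho z w) (?rho u 0)" for z w u :: "complex ^ 'n"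
  have F: "(F has_derivative F' x) (at x)" if "\<And>i. norm (x $ i) < r / 2" for x
    unfolding F_def[abs_def] F'_def[abs_def] by (rule power_series_has_derivative[OF r summ that])
  have F'_scale: "F' x (b *s u) = b * F' x u" if "\<And>i. norm (x $ i) < r / 2" for x b u
    unfolding F'_def by (rule power_series_deriv_scale[OF r summ that])
  \<comment> \<open>The coefficients are real, and swapping and conjugating the two variables
    conjugates every coordinate.\<close>
  have F_cnj: "F (?rho z w) = cnj (F (?rho (cnj_vec w) (cnj_vec z)))" if "norm z < r / 2" "norm w < r / 2" for z w
  proof -
    have pp: "cnj (power_product b (?rho (cnj_vec w) (cnj_vec z))) = power_product b (?rho z w)"
      for b :: "'n + 'n \<Rightarrow> nat"
    proof -
      have "cnj (?rho (cnj_vec w) (cnj_vec z) $ i) = ?rho z w $ i" for i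
        by (cases i) (simp_all add: field_simps)
      then show ?thesis
        by (simp add: power_product_def)
    qed
    have "(\<lambda>k. cnj (of_real (c k) * power_product (a k) (?rho (cnj_vec w) (cnj_vec z)))) sums
        cnj (F (?rho (cnj_vec w) (cnj_vec z)))"
      unfolding F_def sums_cnj
      by (rule power_series_sums[OF r summ]) (rule norm_real_imag_coords_less, use that in simp_all)
    then show ?thesis
      by (simp add: pp F_def sums_iff)
  qed
  have line: "(\<lambda>t. ?rho (s + t *s b) (s' + t *s b') $ i) holomorphic_on T" for s b s' b' i T
    by (cases i) (auto intro!: holomorphic_intros)
  have f_eq: "complex_of_real (f z) = F (?rho z (cnj_vec z))" if "norm z < r" for z
    using f that by (simp add: F_def sums_iff)
  have "complexifies (r / 2) f P P'"
    unfolding complexifies_def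
  proof (intro conjI allI impI)
    fix z w :: "complex ^ 'n" assume zw: "norm z < r / 2" "norm w < r / 2"
    note n = norm_real_imag_coords_less[OF zw]
    have "((\<lambda>x. ?rho x 0 + ?rho 0 w) has_derivative (\<lambda>u. ?rho u 0)) (at z)"
      by (intro has_derivative_add_const bounded_linear_imp_has_derivative bounded_linear_real_imag_coords)
    then have "((\<lambda>x. ?rho x w) has_derivative (\<lambda>u. ?rho u 0)) (at z)"
      by (simp add: real_imag_coords_add[symmetric])
    from has_derivative_compose[OF this F[OF n]]
    show "((\<lambda>x. P x w) has_derivative P' z w) (at z)"
      by (simp add: P_def P'_def[abs_def])
    show "P' z w (b *s v) = b * P' z w v" for b v
      using real_imag_coords_scale[of b v 0] by (simp add: P'_def F'_scale[OF n])
    show "P z w = cnj (P (cnj_vec w) (cnj_vec z))"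
      unfolding P_def by (rule F_cnj[OF zw])
  next
    fix z :: "complex ^ 'n" assume z: "norm z < r / 2"
    then have "norm z < r" using r by simp
    show "P z (cnj_vec z) = of_real (f z)"
      by (simp add: P_def f_eq[OF \<open>norm z < r\<close>])
    have n: "norm (?rho z (cnj_vec z) $ i) < r / 2" for i
      by (rule norm_real_imag_coords_less) (use z in simp_all)
    have lin: "linear (F' (?rho z (cnj_vec z)))"
      using F[OF n] has_derivative_linear by blast
    have "((\<lambda>x. ?rho x (cnj_vec x)) has_derivative (\<lambda>v. ?rho v (cnj_vec v))) (at z)"
      by (rule bounded_linear_imp_has_derivative[OF bounded_linear_real_imag_coords(2)])
    from has_derivative_compose[OF this F[OF n]]
    have "((\<lambda>x. F (?rho x (cnj_vec x))) has_derivative (\<lambda>v. F' (?rho z (cnj_vec z)) (?rho v (cnj_vec v)))) (at z)" .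
    then have *: "((\<lambda>x. complex_of_real (f x)) has_derivative
        (\<lambda>v. F' (?rho z (cnj_vec z)) (?rho v (cnj_vec v)))) (at z)"
      by (rule has_derivative_transform_within_open[OF _ open_ball[of 0 r]])
        (use \<open>norm z < r\<close> f_eq in \<open>simp_all add: dist_norm\<close>)
    \<comment> \<open>The direction (v, cnj v) splits as (v, 0) plus (0, cnj v): the first part
      contributes the complex linear \<open>P'\<close>, the second the antilinear remainder.\<close>
    have "F' (?rho z (cnj_vec z)) (?rho v (cnj_vec v)) =
        P' z (cnj_vec z) v + F' (?rho z (cnj_vec z)) (?rho 0 (cnj_vec v))" for v
      using linear_add[OF lin, of "?rho v 0" "?rho 0 (cnj_vec v)"]
      by (simp add: P'_def real_imag_coords_add[symmetric])
    with * have D: "((\<lambda>x. complex_of_real (f x)) has_derivative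
        (\<lambda>v. P' z (cnj_vec z) v + F' (?rho z (cnj_vec z)) (?rho 0 (cnj_vec v)))) (at z)"
      by simp
    have "F' (?rho z (cnj_vec z)) (?rho 0 (cnj_vec (\<i> *s v))) =
        - \<i> * F' (?rho z (cnj_vec z)) (?rho 0 (cnj_vec v))" for v
      using real_imag_coords_scale[of "- \<i>" 0 "cnj_vec v"] F'_scale[OF n, of "- \<i>" "?rho 0 (cnj_vec v)"]
      by (simp add: cnj_vec_scale)
    then show "\<exists>B. ((\<lambda>x. complex_of_real (f x)) has_derivative (\<lambda>v. P' z (cnj_vec z) v + B v)) (at z) \<and>
        (\<forall>v. B (\<i> *s v) = - \<i> * B v)"
      using D by (intro exI[of _ "\<lambda>v. F' (?rho z (cnj_vec z)) (?rho 0 (cnj_vec v))"]) blast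
  next
    show "line_holomorphic (r / 2) P"
      unfolding line_holomorphic_def P_def F_def
      by (intro allI, rule power_series_holomorphic_on[OF r summ open_line line])
        (rule norm_real_imag_coords_less, blast+)
    show "line_holomorphic (r / 2) (\<lambda>z w. P' z w u)" for u
      unfolding line_holomorphic_def P'_def F'_def
      by (intro allI, rule power_series_deriv_holomorphic_on[OF r summ open_line line])
        (rule norm_real_imag_coords_less, blast+)
  qed
  then show ?thesis
    using that[of "r / 2" P P'] r by simp
qed

section \<open>The first integral\<close>

text \<open>The kernel of the form is stable under multiplication by the imaginary unit. Testing on
  \<open>v\<close> and on its multiple gives A + B = 0 and A - B = 0 there.\<close>

lemma complex_linear_part_eq_0:
  fixes A B :: "complex ^ 'n \<Rightarrow> complex"
  assumes AB: "\<And>v. form \<sigma> z v = 0 \<Longrightarrow> A v + B v = 0"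
    and A: "\<And>v. A (\<i> *s v) = \<i> * A v" and B: "\<And>v. B (\<i> *s v) = - \<i> * B v"
    and v: "form \<sigma> z v = 0"
  shows "A v = 0"
proof -
  have "\<i> * (A v - B v) = 0"
    using AB[of "\<i> *s v"] v by (simp add: form_scale A B right_diff_distrib)
  then show ?thesis
    using AB[OF v] by simp
qed

text \<open>The tangency condition is transferred to the complex linear part of the differential.
  Denominators are cleared so that the resulting expression is line holomorphic and can be continued
  away from \<open>w = cnj_vec z\<close>.\<close>

lemma wedge11_form_numerator_eq_0:
  fixes \<sigma> :: "complex ^ 'n \<Rightarrow> complex ^ 'n"
  assumes p: "complexifies r p P P'" and q: "complexifies r q Q Q'" and z: "norm z < r" "q z \<noteq> 0"
    and tangent: "\<And>u v w. wedge12 (d0 (\<lambda>x. complex_of_real (p x / q x)) z)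
                   (wedge11 (form \<sigma> z) (form_cnj \<sigma> z)) u v w = 0"
  shows "wedge11 (\<lambda>x. P' z (cnj_vec z) x * Q z (cnj_vec z) - P z (cnj_vec z) * Q' z (cnj_vec z) x)
           (form \<sigma> z) u v = 0"
proof (cases "\<sigma> z = 0")
  case True
  then show ?thesis
    by (simp add: wedge11_def form_def)
next
  case False
  let ?w = "cnj_vec z"
  obtain B1 where P: "P z ?w = of_real (p z)"
    and D1: "((\<lambda>x. complex_of_real (p x)) has_derivative (\<lambda>v. P' z ?w v + B1 v)) (at z)"
    and B1: "\<And>v. B1 (\<i> *s v) = - \<i> * B1 v"
    using p z(1) unfolding complexifies_def by blast
  obtain B2 where Q: "Q z ?w = of_real (q z)"
    and D2: "((\<lambda>x. complex_of_real (q x)) has_derivative (\<lambda>v. Q' z ?w v + B2 v)) (at z)"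
    and B2: "\<And>v. B2 (\<i> *s v) = - \<i> * B2 v"
    using q z(1) unfolding complexifies_def by blast
  have zw: "norm z < r" "norm ?w < r"
    using z by simp_all
  have P'_scale: "P' z ?w (c *s v) = c * P' z ?w v" and Q'_scale: "Q' z ?w (c *s v) = c * Q' z ?w v" for c v
    using p q zw unfolding complexifies_def by blast+
  have "linear (P' z ?w)" "linear (Q' z ?w)"
    using p q zw unfolding complexifies_def by (meson has_derivative_linear)+
  then have add: "P' z ?w (u + v) = P' z ?w u + P' z ?w v" "Q' z ?w (u + v) = Q' z ?w u + Q' z ?w v" for u v
    by (simp_all add: linear_add)
  \<comment> \<open>\<open>A\<close> and \<open>B\<close> are the complex linear and antilinear
    parts of the differential of \<open>p / q\<close>, multiplied by the square of
    \<open>q z\<close>.\<close>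
  define A where "A v = P' z ?w v * Q z ?w - P z ?w * Q' z ?w v" for v
  define B where "B v = B1 v * Q z ?w - P z ?w * B2 v" for v
  define \<alpha> where "\<alpha> = d0 (\<lambda>x. complex_of_real (p x / q x)) z"
  have "((\<lambda>x. complex_of_real (p x) / complex_of_real (q x)) has_derivative
      (\<lambda>v. ((P' z ?w v + B1 v) * of_real (q z) - of_real (p z) * (Q' z ?w v + B2 v)) /
        (of_real (q z) * of_real (q z)))) (at z)"
    by (rule has_derivative_divide'[OF D1 D2]) (use z in simp)
  then have D: "((\<lambda>x. complex_of_real (p x / q x)) has_derivative
      (\<lambda>v. (A v + B v) / (of_real (q z) * of_real (q z)))) (at z)"
    by (simp add: A_def B_def P Q algebra_simps)
  have \<alpha>: "\<alpha> = (\<lambda>v. (A v + B v) / (of_real (q z) * of_real (q z)))"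
    unfolding \<alpha>_def d0_def[abs_def] frechet_derivative_at[OF D, symmetric] ..
  have "linear \<alpha>"
    unfolding \<alpha> using D has_derivative_linear by blast
  then have "\<forall>v. form \<sigma> z v = 0 \<longrightarrow> \<alpha> v = 0"
    using wedge_conj_eq_0_iff[of \<sigma> z \<alpha>, OF False] tangent unfolding \<alpha>_def by blast
  then have AB: "A v + B v = 0" if "form \<sigma> z v = 0" for v
    using that z by (simp add: \<alpha>)
  have "A v = 0" if "form \<sigma> z v = 0" for v
  proof (rule complex_linear_part_eq_0[of \<sigma> z A B])
    show "A (\<i> *s v) = \<i> * A v" for v
      by (simp add: A_def P'_scale Q'_scale algebra_simps)
    show "B (\<i> *s v) = - \<i> * B v" for v
      by (simp add: B_def B1 B2 algebra_simps)
  qed (use AB that in auto)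
  moreover have "A (c *s v) = c * A v" "A (u + v) = A u + A v" for c u v
    by (simp_all add: A_def P'_scale Q'_scale add algebra_simps)
  ultimately have "wedge11 A (form \<sigma> z) u v = 0"
    using wedge_eq_0_iff[of \<sigma> z A, OF False] by blast
  then show ?thesis
    by (simp add: A_def[abs_def])
qed

text \<open>The dummy second variable lets the form be multiplied with complexified functions of (z,
  w).\<close>

lemma line_holomorphic_form:
  fixes \<sigma> :: "complex ^ 'n \<Rightarrow> complex ^ 'n"
  assumes "\<And>j. holomorphic_germ (\<lambda>z. \<sigma> z $ j)"
  obtains r where "r > 0" "\<And>v. line_holomorphic r (\<lambda>z _. form \<sigma> z v)"
proof -
  have "\<forall>\<^sub>F z in nhds 0. \<forall>j. \<exists>D. ((\<lambda>z. \<sigma> z $ j) has_derivative D) (at z) \<and> (\<forall>c v. D (c *s v) = c * D v)"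
    using assms unfolding holomorphic_germ_def by (intro eventually_all_finite) auto
  then obtain r where r: "r > 0" and "\<forall>z. dist z 0 < r \<longrightarrow>
      (\<forall>j. \<exists>D. ((\<lambda>z. \<sigma> z $ j) has_derivative D) (at z) \<and> (\<forall>c v. D (c *s v) = c * D v))"
    unfolding eventually_nhds_metric by blast
  then have D: "\<exists>D. ((\<lambda>z. \<sigma> z $ j) has_derivative D) (at z) \<and> (\<forall>c v. D (c *s v) = c * D v)"
    if "norm z < r" for z j
    using that by (simp add: dist_norm)
  have comp: "(\<lambda>t. \<sigma> (a + t *s b) $ j) holomorphic_on {t. norm (a + t *s b) < r \<and> norm (a' + t *s b') < r}"
    for a b a' b' :: "complex ^ 'n" and j
    unfolding holomorphic_on_def
  proof
    fix t assume "t \<in> {t. norm (a + t *s b) < r \<and> norm (a' + t *s b') < r}"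
    then obtain D where D: "((\<lambda>z. \<sigma> z $ j) has_derivative D) (at (a + t *s b))" "\<And>c v. D (c *s v) = c * D v"
      using D[of "a + t *s b" j] by blast
    have "linear (\<lambda>h. h *s b)"
      by (intro linearI) (simp_all add: vec_eq_iff algebra_simps)
    then have "((\<lambda>t. a + t *s b) has_derivative (\<lambda>h. h *s b)) (at t)"
      unfolding linear_conv_bounded_linear
      by (intro has_derivative_add_const[of _ _ _ a, unfolded add.commute[of _ a]] bounded_linear_imp_has_derivative)
    \<comment> \<open>Complex linearity of \<open>D\<close> turns the real derivative along the line
      into multiplication by the complex number \<open>D b\<close>.\<close>
    from has_derivative_compose[OF this D(1)]
    have "((\<lambda>t. \<sigma> (a + t *s b) $ j) has_field_derivative D b) (at t)"
      unfolding has_field_derivative_def D(2) mult.commute[of _ "D b"] .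
    then show "(\<lambda>t. \<sigma> (a + t *s b) $ j) field_differentiable at t within
        {t. norm (a + t *s b) < r \<and> norm (a' + t *s b') < r}"
      using field_differentiable_at_within field_differentiable_def by blast
  qed
  have "line_holomorphic r (\<lambda>z _. form \<sigma> z v)" for v
    unfolding line_holomorphic_def form_def by (intro allI holomorphic_intros comp)
  with r show ?thesis
    by (rule that)
qed

lemma eventually_at_right_line:
  fixes a b :: "complex ^ 'n"
  assumes "eventually X (nhds a)"
  shows "\<forall>\<^sub>F t in at_right 0. X (a + of_real t *s b)"
proof -
  have "((\<lambda>t. a + t *\<^sub>R b) \<longlongrightarrow> a + 0 *\<^sub>R b) (at_right 0)"
    by (intro tendsto_intros)
  then have "filterlim (\<lambda>t. a + of_real t *s b) (nhds a) (at_right 0)"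
    by (simp add: scaleR_eq_scale)
  then show ?thesis
    using assms by (auto simp: filterlim_iff)
qed

text \<open>With \<open>w\<close> fixed, the line through 0 and \<open>z\<close> carries the
  vanishing from a neighbourhood of 0 to \<open>z\<close>, reached at parameter 1.\<close>

lemma line_holomorphic_germ_eq_0:
  assumes H: "line_holomorphic r H" and ev: "\<forall>\<^sub>F z in nhds 0. H z w = 0"
    and z: "norm z < r" and w: "norm w < r"
  shows "H z w = 0"
proof -
  have "\<forall>\<^sub>F t in at_right 0. H (0 + of_real t *s z) (w + of_real t *s 0) = 0"
    using eventually_at_right_line[OF ev] by simp
  moreover have "norm (0 :: complex ^ 'a) < r"
    using le_less_trans[OF norm_ge_zero z] by simp
  ultimately show ?thesis
    using line_holomorphic_vanishing_segment[OF H, of 0 w z 0 1] z w by simp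
qed

text \<open>If no section \<open>P (\<cdot>, w) / Q (\<cdot>, w)\<close> were a nonconstant fraction, the complexified fraction would
  not depend on its first variable, and by conjugation symmetry not on its second one either.\<close>

lemma nonconstant_section_exists:
  fixes p q :: "complex ^ 'n \<Rightarrow> real"
  assumes r: "r > 0" and p: "complexifies r p P P'" and q: "complexifies r q Q Q'"
    and q0: "\<not> (\<forall>\<^sub>F z in nhds 0. q z = 0)" and nonconst: "nonconstant_fraction p q"
  shows "\<exists>w. norm w < r \<and> \<not> (\<forall>\<^sub>F z in nhds 0. Q z w = 0) \<and>
    nonconstant_fraction (\<lambda>z. P z w) (\<lambda>z. Q z w)"
proof (rule ccontr)
  assume contr: "\<not> ?thesis"
  then have alt: "(\<forall>\<^sub>F z in nhds 0. Q z w = 0) \<or> (\<exists>c. \<forall>\<^sub>F z in nhds 0. P z w = c * Q z w)"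
    if "norm w < r" for w
    using contr that unfolding nonconstant_fraction_def by blast
  note lhP = complexifies_line_holomorphic[OF p] and lhQ = complexifies_line_holomorphic[OF q]
  have lh: "line_holomorphic r (\<lambda>z w. P z w - c * Q z w)" for c
    by (intro line_holomorphic_diff line_holomorphic_mult line_holomorphic_const lhP lhQ)
  \<comment> \<open>Both alternatives give the same cross-multiplied identity: the fraction is
    independent of its first variable.\<close>
  have 1: "P z w * Q z1 w = P z1 w * Q z w" if n: "norm z < r" "norm z1 < r" "norm w < r" for z z1 w
    using alt[OF n(3)]
  proof
    assume "\<forall>\<^sub>F z in nhds 0. Q z w = 0"
    then show ?thesis
      using line_holomorphic_germ_eq_0[OF lhQ] n by simp
  next
    assume "\<exists>c. \<forall>\<^sub>F z in nhds 0. P z w = c * Q z w"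
    then obtain c where "\<forall>\<^sub>F z in nhds 0. P z w - c * Q z w = 0"
      by auto
    then have "P z w - c * Q z w = 0" if "norm z < r" for z
      using line_holomorphic_germ_eq_0[OF lh] that n by blast
    from this[OF n(1)] this[OF n(2)] show ?thesis
      by simp
  qed
  have sym: "P z w = cnj (P (cnj_vec w) (cnj_vec z))" "Q z w = cnj (Q (cnj_vec w) (cnj_vec z))"
    if "norm z < r" "norm w < r" for z w
    using p q that unfolding complexifies_def by blast+
  \<comment> \<open>Conjugation symmetry exchanges the two variables in the previous
    identity.\<close>
  have 2: "P z w * Q z w1 = P z w1 * Q z w" if n: "norm z < r" "norm w < r" "norm w1 < r" for z w w1
    unfolding sym[OF n(1,2)] sym[OF n(1,3)] complex_cnj_mult[symmetric]
    using 1[of "cnj_vec w" "cnj_vec w1" "cnj_vec z"] n by simp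
  have diag: "P z (cnj_vec z) = of_real (p z)" "Q z (cnj_vec z) = of_real (q z)" if "norm z < r" for z
    using p q that unfolding complexifies_def by blast+
  obtain z1 where z1: "norm z1 < r" "q z1 \<noteq> 0"
    using q0 r unfolding eventually_nhds_metric by (auto simp: dist_norm)
  \<comment> \<open>The candidate constant is the value of the fraction at a nearby point where it
    is defined.\<close>
  define c where "c = p z1 / q z1"
  define H where "H z w = P z w - of_real c * Q z w" for z w
  let ?w1 = "cnj_vec z1"
  \<comment> \<open>Continuity keeps \<open>Q z ?w1\<close> nonzero near \<open>z1\<close>, so that
    it can be cancelled below.\<close>
  have "((\<lambda>x. Q x ?w1) has_derivative Q' z1 ?w1) (at z1)"
    using q z1 unfolding complexifies_def by (metis norm_cnj_vec)
  then have "continuous (at z1) (\<lambda>x. Q x ?w1)"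
    by (rule has_derivative_continuous)
  moreover have "Q z1 ?w1 \<noteq> 0"
    using diag z1 by simp
  ultimately have "\<forall>\<^sub>F z in nhds z1. Q z ?w1 \<noteq> 0"
    using tendsto_imp_eventually_ne continuous_at unfolding tendsto_at_iff_tendsto_nhds by blast
  moreover have "\<forall>\<^sub>F z in nhds z1. norm z < r"
    using eventually_nhds_in_open[of "ball 0 r" z1] z1 by (simp add: dist_norm)
  ultimately have "\<forall>\<^sub>F z in nhds z1. H z (cnj_vec z) = 0"
  proof eventually_elim
    case (elim z)
    \<comment> \<open>The value is carried from (z, cnj z) to (z, cnj z1) in the second variable,
      then to (z1, cnj z1) in the first.\<close>
    have "P z (cnj_vec z) * Q z ?w1 * Q z1 ?w1 = P z ?w1 * Q z1 ?w1 * Q z (cnj_vec z)"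
      using 2[of z "cnj_vec z" ?w1] elim z1 by (simp add: ac_simps)
    also have "\<dots> = P z1 ?w1 * Q z ?w1 * Q z (cnj_vec z)"
      using 1[of z z1 ?w1] elim z1 by simp
    finally have "P z (cnj_vec z) * Q z1 ?w1 = P z1 ?w1 * Q z (cnj_vec z)"
      using elim by simp
    then show ?case
      using z1 by (simp add: H_def c_def diag field_simps)
  qed
  then have ev: "\<forall>\<^sub>F t in at_right 0. H (z1 + of_real t *s b) (cnj_vec (z1 + of_real t *s b)) = 0" for b
    by (rule eventually_at_right_line)
  have "p z = c * q z" if "norm z < r" for z
  proof -
    \<comment> \<open>Along the segment from \<open>z1\<close> to \<open>z\<close>, paired with its
      conjugate, small real parameters stay where \<open>H\<close> is known to vanish; parameter 1
      is the target.\<close>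
    have "H (z1 + 1 *s (z - z1)) (?w1 + 1 *s cnj_vec (z - z1)) = 0"
    proof (rule line_holomorphic_vanishing_segment)
      show "line_holomorphic r H"
        unfolding H_def by (rule lh)
      show "\<forall>\<^sub>F t in at_right 0. H (z1 + of_real t *s (z - z1)) (?w1 + of_real t *s cnj_vec (z - z1)) = 0"
        using ev[of "z - z1"] by (simp only: cnj_vec_add cnj_vec_scale complex_cnj_complex_of_real)
    qed (use that z1 in \<open>simp_all add: cnj_vec_diff\<close>)
    then have "complex_of_real (p z) = of_real (c * q z)"
      using that by (simp add: H_def cnj_vec_diff diag)
    then show ?thesis
      by (simp only: of_real_eq_iff)
  qed
  then have "\<forall>\<^sub>F z in nhds 0. p z = c * q z"
    using r unfolding eventually_nhds_metric by (auto simp: dist_norm)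
  then show False
    using nonconst unfolding nonconstant_fraction_def by blast
qed

lemma complexifies_section_holomorphic_germ:
  assumes "complexifies r f P P'" "norm w < r"
  shows "holomorphic_germ (\<lambda>z. P z w)"
proof -
  have "0 < r"
    using le_less_trans[OF norm_ge_zero assms(2)] .
  then have "\<forall>\<^sub>F z in nhds 0. norm z < r"
    unfolding eventually_nhds_metric by (auto simp: dist_norm)
  then show ?thesis
    unfolding holomorphic_germ_def
    by eventually_elim (use assms in \<open>unfold complexifies_def, blast\<close>)
qed

theorem theorem1:
  fixes \<sigma> :: "complex ^ 'n \<Rightarrow> complex ^ 'n" and p q :: "complex ^ 'n \<Rightarrow> real"
  assumes "CARD('n) \<ge> 2"
    and "foliation_germ \<sigma>"
    and "real_meromorphic_germ p q"
    and "nonconstant_fraction p q"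
    and "tangent_to_levels \<sigma> p q"
  shows "\<exists>P Q. meromorphic_germ P Q \<and> nonconstant_fraction P Q \<and> first_integral \<sigma> P Q"
proof -
  obtain r1 P P' where r1: "r1 > 0" "complexifies r1 p P P'"
    using assms(3) real_analytic_germ_complexifies unfolding real_meromorphic_germ_def by blast
  obtain r2 Q Q' where r2: "r2 > 0" "complexifies r2 q Q Q'"
    using assms(3) real_analytic_germ_complexifies unfolding real_meromorphic_germ_def by blast
  have "\<And>j. holomorphic_germ (\<lambda>z. \<sigma> z $ j)"
    using assms(2) unfolding foliation_germ_def by blast
  then obtain r3 where r3: "r3 > 0" "\<And>v. line_holomorphic r3 (\<lambda>z _. form \<sigma> z v)"
    by (rule line_holomorphic_form) (rule that)
  obtain r4 where r4: "r4 > 0" "\<And>z u v w. dist z 0 < r4 \<Longrightarrow> q z \<noteq> 0 \<Longrightarrow>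
      wedge12 (d0 (\<lambda>x. complex_of_real (p x / q x)) z) (wedge11 (form \<sigma> z) (form_cnj \<sigma> z)) u v w = 0"
    using assms(5) unfolding tangent_to_levels_def eventually_nhds_metric by blast
  define r where "r = min (min r1 r2) (min r3 r4)"
  have r: "r > 0" "r \<le> r1" "r \<le> r2" "r \<le> r3" "r \<le> r4"
    using r1 r2 r3 r4 by (simp_all add: r_def)
  have p: "complexifies r p P P'" and q: "complexifies r q Q Q'"
    and s: "line_holomorphic r (\<lambda>z _. form \<sigma> z v)" for v
    using complexifies_mono r1 r2 r3 r line_holomorphic_mono by blast+
  obtain w where w: "norm w < r" "\<not> (\<forall>\<^sub>F z in nhds 0. Q z w = 0)"
    "nonconstant_fraction (\<lambda>z. P z w) (\<lambda>z. Q z w)"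
    using nonconstant_section_exists[OF r(1) p q _ assms(4)] assms(3)
    unfolding real_meromorphic_germ_def by blast
  \<comment> \<open>The quotient rule numerator of the differential in \<open>z\<close> of the
    complexified fraction.\<close>
  define A where "A z w v = P' z w v * Q z w - P z w * Q' z w v" for z w v
  have lhA: "line_holomorphic r (\<lambda>z w. A z w v)" for v
    using p q unfolding A_def complexifies_def by (intro line_holomorphic_diff line_holomorphic_mult) blast+
  \<comment> \<open>The factor \<open>Q z w\<close> makes the identity hold also where
    \<open>q z = 0\<close>, about which tangency says nothing. It is cancelled later, where the
    section's denominator is nonzero.\<close>
  have vanish: "Q z w * wedge11 (A z w) (form \<sigma> z) u v = 0" if n: "norm z < r" "norm w < r" for z w u v
  proof (rule line_holomorphic_vanishing_totally_real[OF _ _ n])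
    show "line_holomorphic r (\<lambda>z w. Q z w * wedge11 (A z w) (form \<sigma> z) u v)"
      unfolding wedge11_def
      by (rule line_holomorphic_mult[OF complexifies_line_holomorphic[OF q] line_holomorphic_diff
            [OF line_holomorphic_mult[OF lhA s] line_holomorphic_mult[OF lhA s]]])
    fix z :: "complex ^ 'n" assume z: "norm z < r"
    show "Q z (cnj_vec z) * wedge11 (A z (cnj_vec z)) (form \<sigma> z) u v = 0"
    proof (cases "q z = 0")
      case True
      then show ?thesis
        using complexifies_diag[OF q z] by simp
    next
      case False
      have "dist z 0 < r4"
        using z r by simp
      from wedge11_form_numerator_eq_0[OF p q z False r4(2)[OF this False]] show ?thesis
        by (simp add: A_def[abs_def])
    qed
  qed
  have "first_integral \<sigma> (\<lambda>z. P z w) (\<lambda>z. Q z w)"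
  proof -
    have "\<forall>\<^sub>F z in nhds 0. norm (z :: complex ^ 'n) < r"
      using r unfolding eventually_nhds_metric by (auto simp: dist_norm)
    then show ?thesis
      unfolding first_integral_def
    proof eventually_elim
      case (elim z)
      show ?case
      proof (intro impI allI)
        fix u v assume Q0: "Q z w \<noteq> 0"
        have "((\<lambda>x. P x w) has_derivative P' z w) (at z)" "((\<lambda>x. Q x w) has_derivative Q' z w) (at z)"
          using p q elim w unfolding complexifies_def by blast+
        from has_derivative_divide'[OF this Q0]
        have D: "((\<lambda>x. P x w / Q x w) has_derivative (\<lambda>v. A z w v / (Q z w * Q z w))) (at z)"
          by (simp add: A_def)
        have "wedge11 (\<lambda>v. A z w v / (Q z w * Q z w)) (form \<sigma> z) u v =
            wedge11 (A z w) (form \<sigma> z) u v / (Q z w * Q z w)"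
          by (simp add: wedge11_def diff_divide_distrib)
        also have "\<dots> = 0"
          using vanish[OF elim w(1)] Q0 by simp
        finally show "wedge11 (d0 (\<lambda>x. P x w / Q x w) z) (form \<sigma> z) u v = 0"
          unfolding d0_def[abs_def] frechet_derivative_at[OF D, symmetric] .
      qed
    qed
  qed
  moreover have "meromorphic_germ (\<lambda>z. P z w) (\<lambda>z. Q z w)"
    using complexifies_section_holomorphic_germ p q w unfolding meromorphic_germ_def by blast
  ultimately show ?thesis
    using w(3) by blast
qed

end
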